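(* For any ring $R$, there is an $O(n^2)$-time deterministic reduction from $\mathrm{MMV}_R$ on $n\times n$ matrices to $\mathrm{SymMMV}_R$ on $3n\times 3n$ matrices.
   Context: $\mathrm{MMV}_R$: given $A,B,C\in R^{n\times n}$, decide whether $AB=C$. $\mathrm{SymMMV}_R$: given symmetric matrices $A,B\in R^{n\times n}$ and an arbitrary matrix $C\in R^{n\times n}$, decide whether $AB=C$. A reduction maps each instance of the first problem to an instance of the second with the same yes/no answer; arithmetic operations over $R$ are counted as constant time. *)

theory Defs
  imports "Jordan_Normal_Form.Matrix" "HOL-Library.Landau_Symbols"
begin

section \<open>The decision problems\<close>

text \<open>A problem assigns to each size its set of instances and singles out the yes-instances.\<close>

record 'i problem =
  instances :: "nat \<Rightarrow> 'i set"
  yes :: "'i \<Rightarrow> bool"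

type_synonym 'a mat_triple = "'a mat \<times> 'a mat \<times> 'a mat"

definition symmetric_mat :: "'a mat \<Rightarrow> bool" where
  "symmetric_mat A \<longleftrightarrow> transpose_mat A = A"

definition MMV :: "('a::ring) mat_triple problem" where
  "MMV = \<lparr> instances = (\<lambda>n. {(A, B, C).
             A \<in> carrier_mat n n \<and> B \<in> carrier_mat n n \<and> C \<in> carrier_mat n n}),
           yes = (\<lambda>(A, B, C). A * B = C) \<rparr>"

definition SymMMV :: "('a::ring) mat_triple problem" where
  "SymMMV = \<lparr> instances = (\<lambda>n. {(A, B, C).
                A \<in> carrier_mat n n \<and> B \<in> carrier_mat n n \<and> C \<in> carrier_mat n n \<and>
                symmetric_mat A \<and> symmetric_mat B}),
              yes = (\<lambda>(A, B, C). A * B = C) \<rparr>"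

section \<open>Unit-cost random access machines over a ring\<close>

text \<open>
  Programs act on index registers, which hold natural numbers, and on finitely many unbounded
  one-dimensional arrays of ring elements. Register and array names are literals in the program
  text. A ring cell is accessed indirectly: the pair \<open>(k, x)\<close> denotes the cell of array \<open>k\<close> whose
  address is the current content of index register \<open>x\<close>. A program contains only finitely many ring
  constants. Index registers admit addition and truncated subtraction but not multiplication,
  as is usual for unit-cost machines with registers of unbounded size.
\<close>

type_synonym cell = "nat \<times> nat"

datatype 'a com =
    Skip
  | IConst nat nat
  | ICopy nat nat
  | IAdd nat nat nat
  | ISub nat nat nat
  | RConst cell 'a
  | RCopy cell cell
  | RAdd cell cell cell
  | RSub cell cell cell
  | RMult cell cell cell
  | Seq "'a com" "'a com"
  | IfLess nat nat "'a com" "'a com"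
  | IfREq cell cell "'a com" "'a com"
  | WhileLess nat nat "'a com"

record 'a state =
  reg :: "nat \<Rightarrow> nat"
  arr :: "nat \<Rightarrow> nat \<Rightarrow> 'a"

definition get :: "'a state \<Rightarrow> cell \<Rightarrow> 'a" where
  "get s p = arr s (fst p) (reg s (snd p))"

definition put :: "cell \<Rightarrow> 'a \<Rightarrow> 'a state \<Rightarrow> 'a state" where
  "put p v s = s\<lparr>arr := (arr s)(fst p := (arr s (fst p))(reg s (snd p) := v))\<rparr>"

definition set_reg :: "nat \<Rightarrow> nat \<Rightarrow> 'a state \<Rightarrow> 'a state" where
  "set_reg x v s = s\<lparr>reg := (reg s)(x := v)\<rparr>"

text \<open>\<open>exec c s t s'\<close>: started in \<open>s\<close>, the program \<open>c\<close> halts in \<open>s'\<close> after exactly \<open>t\<close> unit-cost steps.\<close>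

inductive exec :: "('a::ring) com \<Rightarrow> 'a state \<Rightarrow> nat \<Rightarrow> 'a state \<Rightarrow> bool" where
  Skip: "exec Skip s 1 s"
| IConst: "exec (IConst x k) s 1 (set_reg x k s)"
| ICopy: "exec (ICopy x y) s 1 (set_reg x (reg s y) s)"
| IAdd: "exec (IAdd x y z) s 1 (set_reg x (reg s y + reg s z) s)"
| ISub: "exec (ISub x y z) s 1 (set_reg x (reg s y - reg s z) s)"
| RConst: "exec (RConst p a) s 1 (put p a s)"
| RCopy: "exec (RCopy p q) s 1 (put p (get s q) s)"
| RAdd: "exec (RAdd p q r) s 1 (put p (get s q + get s r) s)"
| RSub: "exec (RSub p q r) s 1 (put p (get s q - get s r) s)"
| RMult: "exec (RMult p q r) s 1 (put p (get s q * get s r) s)"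
| Seq: "exec c s t s' \<Longrightarrow> exec d s' u s'' \<Longrightarrow> exec (Seq c d) s (t + u) s''"
| IfLess_True: "reg s x < reg s y \<Longrightarrow> exec c s t s' \<Longrightarrow> exec (IfLess x y c d) s (t + 1) s'"
| IfLess_False: "\<not> reg s x < reg s y \<Longrightarrow> exec d s t s' \<Longrightarrow> exec (IfLess x y c d) s (t + 1) s'"
| IfREq_True: "get s p = get s q \<Longrightarrow> exec c s t s' \<Longrightarrow> exec (IfREq p q c d) s (t + 1) s'"
| IfREq_False: "get s p \<noteq> get s q \<Longrightarrow> exec d s t s' \<Longrightarrow> exec (IfREq p q c d) s (t + 1) s'"
| WhileLess_False: "\<not> reg s x < reg s y \<Longrightarrow> exec (WhileLess x y c) s 1 s"
| WhileLess_True: "reg s x < reg s y \<Longrightarrow> exec c s t s' \<Longrightarrow> exec (WhileLess x y c) s' u s'' \<Longrightarrow>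
    exec (WhileLess x y c) s (t + u + 1) s''"

inductive_cases exec_elims:
  "exec Skip s t s'"
  "exec (IConst x k) s t s'"
  "exec (ICopy x y) s t s'"
  "exec (IAdd x y z) s t s'"
  "exec (ISub x y z) s t s'"
  "exec (RConst p a) s t s'"
  "exec (RCopy p q) s t s'"
  "exec (RAdd p q r) s t s'"
  "exec (RSub p q r) s t s'"
  "exec (RMult p q r) s t s'"
  "exec (Seq c d) s t s'"
  "exec (IfLess x y c d) s t s'"
  "exec (IfREq p q c d) s t s'"
  "exec (WhileLess x y c) s t s'"

lemma exec_deterministic:
  "exec c s t s' \<Longrightarrow> exec c s u s'' \<Longrightarrow> u = t \<and> s'' = s'"
proof (induction arbitrary: u s'' rule: exec.induct)
  case (Seq c s t s1 d v s2)
  from Seq.prems show ?case by (rule exec_elims(11)) (metis Seq.IH)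
next
  case (WhileLess_True s x y c t s1 v s2)
  from WhileLess_True.prems show ?case
    by (rule exec_elims(14)) (metis WhileLess_True.hyps(1) WhileLess_True.IH Suc_eq_plus1)+
qed (erule exec_elims; force)+

section \<open>Input, output and reductions\<close>

definition row_major :: "nat \<Rightarrow> ('a::zero) mat \<Rightarrow> nat \<Rightarrow> 'a" where
  "row_major n A = (\<lambda>a. if a < n * n then A $$ (a div n, a mod n) else 0)"

definition mat_of_array :: "nat \<Rightarrow> (nat \<Rightarrow> 'a) \<Rightarrow> 'a mat" where
  "mat_of_array m f = mat m m (\<lambda>(i, j). f (i * m + j))"

text \<open>
  The input dimension is in index register 0 and the input matrices are in arrays 0, 1, 2; all
  other registers and cells are initially zero. On termination the output dimension is in index
  register 0 and the output matrices are in arrays 3, 4, 5.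
\<close>

definition init_state :: "nat \<Rightarrow> ('a::zero) mat_triple \<Rightarrow> 'a state" where
  "init_state n = (\<lambda>(A, B, C).
     \<lparr> reg = (\<lambda>_. 0)(0 := n),
       arr = (\<lambda>_ _. 0)(0 := row_major n A, 1 := row_major n B, 2 := row_major n C) \<rparr>)"

definition out_dim :: "'a state \<Rightarrow> nat" where
  "out_dim s = reg s 0"

definition out_triple :: "'a state \<Rightarrow> 'a mat_triple" where
  "out_triple s = (mat_of_array (out_dim s) (arr s 3),
                   mat_of_array (out_dim s) (arr s 4),
                   mat_of_array (out_dim s) (arr s 5))"

text \<open>
  The program \<open>c\<close> maps every size-\<open>n\<close> instance of \<open>P\<close>, in at most \<open>T n\<close> steps, to a size-\<open>f n\<close>
  instance of \<open>Q\<close> with the same answer. The one program \<open>c\<close> has to work for all sizes.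
\<close>

definition reduction_in_time ::
  "('a::ring) com \<Rightarrow> (nat \<Rightarrow> nat) \<Rightarrow> 'a mat_triple problem \<Rightarrow> 'a mat_triple problem \<Rightarrow> (nat \<Rightarrow> nat) \<Rightarrow> bool"
where
  "reduction_in_time c T P Q f \<longleftrightarrow>
     (\<forall>n. \<forall>I \<in> instances P n. \<exists>t s.
        exec c (init_state n I) t s \<and> t \<le> T n \<and>
        out_dim s = f n \<and> out_triple s \<in> instances Q (f n) \<and>
        (yes P I \<longleftrightarrow> yes Q (out_triple s)))"

end

theory Submission
  imports Defs
begin

text \<open>
  Write \<open>E r c X\<close> for the \<open>3n \<times> 3n\<close> matrix whose only nonzero \<open>n \<times> n\<close> block is \<open>X\<close>, in block
  position \<open>(r, c)\<close>. Then
  \<open>(E 0 1 A + E 1 0 A\<^sup>T) * (E 1 2 B + E 2 1 B\<^sup>T) = E 0 2 (A * B)\<close>,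
  because the other three products of summands have mismatched inner block indices. Both factors
  are symmetric, so \<open>(A, B, C)\<close> is mapped to these factors and \<open>E 0 2 C\<close>. Only
  \<open>5n\<^sup>2\<close> cells of the output are ever written, their row-major addresses being sums of
  multiples of \<open>n\<close> and \<open>3n\<close> that are kept in registers.
\<close>

section \<open>Block matrices\<close>

definition block :: "nat \<Rightarrow> nat \<Rightarrow> nat \<Rightarrow> ('a::zero) mat \<Rightarrow> 'a mat" where
  "block n r c X = mat (3 * n) (3 * n)
     (\<lambda>(p, q). if p div n = r \<and> q div n = c then X $$ (p mod n, q mod n) else 0)"

definition sym_block :: "nat \<Rightarrow> nat \<Rightarrow> nat \<Rightarrow> ('a::monoid_add) mat \<Rightarrow> 'a mat" where
  "sym_block n r c X = block n r c X + block n c r (transpose_mat X)"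

lemma block_carrier [simp]: "block n r c X \<in> carrier_mat (3 * n) (3 * n)"
  by (simp add: block_def)

lemma block_dim [simp]: "dim_row (block n r c X) = 3 * n" "dim_col (block n r c X) = 3 * n"
  by (simp_all add: block_def)

lemma sym_block_carrier [simp]: "sym_block n r c X \<in> carrier_mat (3 * n) (3 * n)"
  by (simp add: sym_block_def)

lemma row_major_index_less:
  fixes i j m n :: nat
  assumes "i < m" "j < n"
  shows "i * n + j < m * n"
proof -
  have "Suc i * n \<le> m * n"
    using assms by (intro mult_right_mono) auto
  then show ?thesis
    using assms(2) unfolding mult_Suc by linarith
qed

text \<open>The hypothesis excludes \<open>n = 0\<close>, where \<open>p mod 0 = p\<close>.\<close>

lemma mod_less_of_less_3: "p < 3 * n \<Longrightarrow> p mod n < (n::nat)"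
  by (cases n) auto

lemma transpose_block:
  assumes "X \<in> carrier_mat n n"
  shows "transpose_mat (block n r c X) = block n c r (transpose_mat X)"
  using assms by (intro eq_matI) (auto simp: block_def mod_less_of_less_3)

lemma symmetric_sym_block:
  fixes X :: "'a::ring mat"
  assumes "X \<in> carrier_mat n n"
  shows "symmetric_mat (sym_block n r c X)"
proof -
  have "transpose_mat (sym_block n r c X) = block n c r (transpose_mat X) + block n r c X"
    using assms by (simp add: sym_block_def transpose_add[of _ "3 * n" "3 * n"] transpose_block)
  also have "\<dots> = sym_block n r c X"
    by (simp add: sym_block_def comm_add_mat[of _ "3 * n" "3 * n"])
  finally show ?thesis
    by (simp add: symmetric_mat_def)
qed

section \<open>Products of block matrices\<close>

lemma sum_block_index:
  fixes g :: "nat \<Rightarrow> 'a::comm_monoid_add"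
  assumes "r < 3"
  shows "(\<Sum>l<3 * n. if l div n = r then g (l mod n) else 0) = (\<Sum>l<n. g l)"
proof -
  have "(\<Sum>l<3 * n. if l div n = r then g (l mod n) else 0)
      = (\<Sum>l \<in> {l. l < 3 * n \<and> l div n = r}. g (l mod n))"
    by (rule sum.mono_neutral_cong_right) auto
  also have "\<dots> = (\<Sum>l<n. g l)"
  \<comment> \<open>Indices in block \<open>r\<close> are \<open>r * n + l\<close> with
    \<open>l < n\<close>; \<open>mod n\<close> recovers the offset.\<close>
  proof (rule sum.reindex_bij_witness[where i = "\<lambda>l. r * n + l" and j = "\<lambda>l. l mod n"])
    fix l assume "l \<in> {..<n}"
    then show "r * n + l \<in> {l. l < 3 * n \<and> l div n = r}"
      using assms by (simp add: row_major_index_less)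
  qed (auto simp: mod_less_of_less_3)
  finally show ?thesis .
qed

text \<open>An inner index contributes only if its block number equals both \<open>c\<close> and
  \<open>c'\<close>, so these products behave like those of matrix units.\<close>

lemma block_mult_block:
  fixes X Y :: "'a::ring mat"
  assumes "X \<in> carrier_mat n n" "Y \<in> carrier_mat n n" "c < 3"
  shows "block n r c X * block n c' d Y =
    (if c = c' then block n r d (X * Y) else 0\<^sub>m (3 * n) (3 * n))"
proof (rule eq_matI)
  let ?R = "if c = c' then block n r d (X * Y) else 0\<^sub>m (3 * n) (3 * n)"
  fix p q assume "p < dim_row ?R" "q < dim_col ?R"
  then have pq: "p < 3 * n" "q < 3 * n"
    by (auto split: if_splits)
  have "(block n r c X * block n c' d Y) $$ (p, q) =
      (\<Sum>l<3 * n. block n r c X $$ (p, l) * block n c' d Y $$ (l, q))"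
    using pq by (simp add: scalar_prod_def atLeast0LessThan)
  \<comment> \<open>Under the guard \<open>l div n = c\<close>, the second factor's condition
    \<open>l div n = c'\<close> becomes \<open>c = c'\<close>, which no longer depends on
    \<open>l\<close>.\<close>
  also have "\<dots> = (\<Sum>l<3 * n. if l div n = c then
      (if p div n = r \<and> c = c' \<and> q div n = d
       then X $$ (p mod n, l mod n) * Y $$ (l mod n, q mod n) else 0) else 0)"
    using pq by (intro sum.cong) (auto simp: block_def)
  also have "\<dots> = (\<Sum>l<n. if p div n = r \<and> c = c' \<and> q div n = d
       then X $$ (p mod n, l) * Y $$ (l, q mod n) else 0)"
    by (rule sum_block_index[OF \<open>c < 3\<close>])
  also have "\<dots> = ?R $$ (p, q)"
    using pq assms(1,2)
    by (auto simp: block_def scalar_prod_def atLeast0LessThan mod_less_of_less_3)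
  finally show "(block n r c X * block n c' d Y) $$ (p, q) = ?R $$ (p, q)" .
qed auto

text \<open>Entry \<open>(r * n + i, c * n + j)\<close> of the block matrix gives back
  \<open>X $$ (i, j)\<close>. Injectivity is what keeps no-instances from becoming
  yes-instances.\<close>

lemma block_inject:
  assumes "X \<in> carrier_mat n n" "Y \<in> carrier_mat n n" "r < 3" "c < 3"
  shows "block n r c X = block n r c Y \<longleftrightarrow> X = Y"
proof
  assume eq: "block n r c X = block n r c Y"
  show "X = Y"
  proof (rule eq_matI)
    fix i j assume "i < dim_row Y" "j < dim_col Y"
    then have ij: "i < n" "j < n"
      using assms by auto
    have "r * n + i < 3 * n" "c * n + j < 3 * n"
      using assms ij by (simp_all add: row_major_index_less)
    then show "X $$ (i, j) = Y $$ (i, j)"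
      using arg_cong[OF eq, of "\<lambda>M. M $$ (r * n + i, c * n + j)"] ij
      by (simp add: block_def)
  qed (use assms in auto)
qed simp

lemma sym_block_mult_sym_block:
  fixes A B :: "'a::ring mat"
  assumes "A \<in> carrier_mat n n" "B \<in> carrier_mat n n"
  shows "sym_block n 0 1 A * sym_block n 1 2 B = block n 0 2 (A * B)"
proof -
  have "sym_block n 0 1 A * sym_block n 1 2 B =
      (block n 0 1 A * block n 1 2 B + block n 1 0 (transpose_mat A) * block n 1 2 B) +
      (block n 0 1 A * block n 2 1 (transpose_mat B) +
       block n 1 0 (transpose_mat A) * block n 2 1 (transpose_mat B))"
    by (simp add: sym_block_def add_mult_distrib_mat[of _ "3 * n" "3 * n" _ _ "3 * n"]
        mult_add_distrib_mat[of _ "3 * n" "3 * n" _ "3 * n"] mult_carrier_mat[of _ "3 * n" "3 * n"])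
  then show ?thesis
    using assms by (simp add: block_mult_block right_add_zero_mat[of _ "3 * n" "3 * n"])
qed

section \<open>Filling a block entry by entry\<close>

definition upd_mat :: "'a mat \<Rightarrow> nat \<Rightarrow> nat \<Rightarrow> 'a \<Rightarrow> 'a mat" where
  "upd_mat M p q v = mat (dim_row M) (dim_col M)
     (\<lambda>(a, b). if a = p \<and> b = q then v else M $$ (a, b))"

text \<open>The part of \<open>A\<close> copied after \<open>k\<close> steps in row-major order; the
  zeros match the initially zero output arrays.\<close>

definition prefix_mat :: "nat \<Rightarrow> nat \<Rightarrow> ('a::zero) mat \<Rightarrow> 'a mat" where
  "prefix_mat n k A = mat n n (\<lambda>(i, j). if i * n + j < k then A $$ (i, j) else 0)"

lemma prefix_mat_carrier [simp]: "prefix_mat n k A \<in> carrier_mat n n"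
  by (simp add: prefix_mat_def)

lemma row_major_index_eq_iff:
  fixes i j p q n :: nat
  assumes "j < n" "q < n"
  shows "p * n + q = i * n + j \<longleftrightarrow> p = i \<and> q = j"
proof
  assume "p * n + q = i * n + j"
  then have "(p * n + q) div n = (i * n + j) div n" "(p * n + q) mod n = (i * n + j) mod n"
    by simp_all
  then show "p = i \<and> q = j"
    using assms by simp
qed simp

lemma prefix_mat_0: "prefix_mat n 0 A = 0\<^sub>m n n"
  by (intro eq_matI) (auto simp: prefix_mat_def)

lemma prefix_mat_full:
  assumes "A \<in> carrier_mat n n"
  shows "prefix_mat n (n * n) A = A"
  using assms by (intro eq_matI) (auto simp: prefix_mat_def row_major_index_less)

lemma prefix_mat_Suc:
  assumes "j < n"
  shows "prefix_mat n (Suc (i * n + j)) A = upd_mat (prefix_mat n (i * n + j) A) i j (A $$ (i, j))"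
  using assms
  by (intro eq_matI) (auto simp: prefix_mat_def upd_mat_def less_Suc_eq row_major_index_eq_iff)

text \<open>With \<open>q < m\<close>, quotient and remainder by \<open>m\<close> recover the
  position from the address, so the write touches no other matrix entry.\<close>

lemma mat_of_array_upd:
  assumes "q < m"
  shows "mat_of_array m (f(p * m + q := v)) = upd_mat (mat_of_array m f) p q v"
  using assms
  by (intro eq_matI) (auto simp: mat_of_array_def upd_mat_def row_major_index_eq_iff)

lemma block_0: "block n r c (0\<^sub>m n n) = 0\<^sub>m (3 * n) (3 * n)"
  by (intro eq_matI) (auto simp: block_def mod_less_of_less_3)

lemma sym_block_0: "sym_block n r c (0\<^sub>m n n) = (0\<^sub>m (3 * n) (3 * n) :: 'a::ring mat)"
  by (simp add: sym_block_def block_0)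

lemma block_upd_mat:
  assumes "X \<in> carrier_mat n n" "i < n" "j < n"
  shows "block n r c (upd_mat X i j v) = upd_mat (block n r c X) (r * n + i) (c * n + j) v"
proof -
  have *: "p = k * n + l \<longleftrightarrow> p div n = k \<and> p mod n = l" if "l < n" for p k l :: nat
    using that by auto
  show ?thesis
    using assms
    by (intro eq_matI) (auto simp: block_def upd_mat_def mod_less_of_less_3 *)
qed

text \<open>Each entry is stored twice, at mirror positions. As \<open>r \<noteq> c\<close>, the two
  blocks are disjoint, so at each written position the other summand is zero.\<close>

lemma sym_block_upd_mat:
  fixes X :: "'a::ring mat"
  assumes "X \<in> carrier_mat n n" "i < n" "j < n" "r \<noteq> c"
  shows "sym_block n r c (upd_mat X i j v) =
    upd_mat (upd_mat (sym_block n r c X) (r * n + i) (c * n + j) v) (c * n + j) (r * n + i) v"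
proof -
  have "transpose_mat (upd_mat X i j v) = upd_mat (transpose_mat X) j i v"
    by (intro eq_matI) (auto simp: upd_mat_def)
  then have "sym_block n r c (upd_mat X i j v) =
      upd_mat (block n r c X) (r * n + i) (c * n + j) v +
      upd_mat (block n c r (transpose_mat X)) (c * n + j) (r * n + i) v"
    using assms by (simp add: sym_block_def block_upd_mat)
  also have "\<dots> = upd_mat (upd_mat (sym_block n r c X) (r * n + i) (c * n + j) v)
      (c * n + j) (r * n + i) v"
  proof -
    have "r * n + i \<noteq> c * n + j"
    proof
      assume "r * n + i = c * n + j"
      then have "(r * n + i) div n = (c * n + j) div n"
        by simp
      then show False
        using assms by simp
    qed
    then show ?thesis
      using assms by (intro eq_matI) (auto simp: sym_block_def upd_mat_def block_def)
  qed
  finally show ?thesis .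
qed

section \<open>Bounded-time execution\<close>

text \<open>Total correctness with a time budget. As \<open>exec\<close> is deterministic, a run
  with these properties is the only one.\<close>

definition halts_within :: "('a::ring) com \<Rightarrow> 'a state \<Rightarrow> nat \<Rightarrow> ('a state \<Rightarrow> bool) \<Rightarrow> bool" where
  "halts_within c s b Q \<longleftrightarrow> (\<exists>t s'. exec c s t s' \<and> t \<le> b \<and> Q s')"

text \<open>
  On a program without branches and loops, \<open>steps\<close> is the exact running time and \<open>run\<close> the state
  transformer; the other programs get arbitrary values.
\<close>

fun straight :: "'a com \<Rightarrow> bool" where
  "straight (Seq c d) = (straight c \<and> straight d)"
| "straight (IfLess x y c d) = False"
| "straight (IfREq p q c d) = False"
| "straight (WhileLess x y c) = False"
| "straight c = True"

fun steps :: "'a com \<Rightarrow> nat" where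
  "steps (Seq c d) = steps c + steps d"
| "steps c = 1"

fun run :: "('a::ring) com \<Rightarrow> 'a state \<Rightarrow> 'a state" where
  "run (IConst x k) s = set_reg x k s"
| "run (ICopy x y) s = set_reg x (reg s y) s"
| "run (IAdd x y z) s = set_reg x (reg s y + reg s z) s"
| "run (ISub x y z) s = set_reg x (reg s y - reg s z) s"
| "run (RConst p a) s = put p a s"
| "run (RCopy p q) s = put p (get s q) s"
| "run (RAdd p q r) s = put p (get s q + get s r) s"
| "run (RSub p q r) s = put p (get s q - get s r) s"
| "run (RMult p q r) s = put p (get s q * get s r) s"
| "run (Seq c d) s = run d (run c s)"
| "run c s = s"

lemma exec_straight: "straight c \<Longrightarrow> exec c s (steps c) (run c s)"
  by (induction c arbitrary: s) (auto intro: exec.intros simp flip: One_nat_def)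

lemma halts_within_straight:
  assumes "straight c" "steps c \<le> b" "Q (run c s)"
  shows "halts_within c s b Q"
  using assms exec_straight unfolding halts_within_def by blast

lemma halts_within_mono:
  assumes "halts_within c s b Q" "b \<le> b'" "\<And>s. Q s \<Longrightarrow> Q' s"
  shows "halts_within c s b' Q'"
  using assms unfolding halts_within_def by (meson order_trans)

lemma halts_within_Seq:
  assumes "halts_within c s b Q" "\<And>s'. Q s' \<Longrightarrow> halts_within d s' b' Q'"
  shows "halts_within (Seq c d) s (b + b') Q'"
  using assms unfolding halts_within_def by (meson exec.Seq add_mono)

text \<open>\<open>J k\<close> describes the state after \<open>k\<close> iterations, and
  \<open>guard\<close> forces exactly \<open>N\<close> of them. Each pays 1 for its successful test;
  the failing test at the end pays the last 1.\<close>

lemma halts_within_WhileLess: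
  assumes guard: "\<And>k s. J k s \<Longrightarrow> reg s x < reg s y \<longleftrightarrow> k < N"
    and body: "\<And>k s. k < N \<Longrightarrow> J k s \<Longrightarrow> halts_within c s b (J (Suc k))"
    and init: "J 0 s"
  shows "halts_within (WhileLess x y c) s (N * (b + 1) + 1) (J N)"
proof -
  \<comment> \<open>Induct on the number \<open>d\<close> of remaining iterations, starting from any
    \<open>k\<close>.\<close>
  have "halts_within (WhileLess x y c) s (d * (b + 1) + 1) (J N)" if "J k s" "k + d = N" for k d s
    using that
  proof (induction d arbitrary: k s)
    case 0
    then have "\<not> reg s x < reg s y"
      using guard by simp
    then show ?case
      using 0 exec.WhileLess_False unfolding halts_within_def by fastforce
  next
    case (Suc d)
    then have "k < N"
      by simp
    then obtain t s' where t: "exec c s t s'" "t \<le> b" "J (Suc k) s'"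
      using body Suc.prems(1) unfolding halts_within_def by blast
    obtain u s'' where u: "exec (WhileLess x y c) s' u s''" "u \<le> d * (b + 1) + 1" "J N s''"
      using Suc.IH[OF t(3)] Suc.prems(2) unfolding halts_within_def by auto
    have "exec (WhileLess x y c) s (t + u + 1) s''"
      using guard[OF Suc.prems(1)] \<open>k < N\<close> t(1) u(1) by (intro exec.WhileLess_True) auto
    moreover have "t + u + 1 \<le> Suc d * (b + 1) + 1"
      using t(2) u(2) by simp
    ultimately show ?case
      using u(3) unfolding halts_within_def by blast
  qed
  from this[of 0 s N] init show ?thesis
    by simp
qed

section \<open>The reduction program\<close>

text \<open>
  Register 0 holds \<open>n\<close>, 1 the constant 1, 2 holds \<open>3n\<close>, 3 holds \<open>n * 3n\<close>, 4 and 5 hold \<open>i\<close> and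
  \<open>i * 3n\<close>, 6 and 7 hold \<open>j\<close> and \<open>j * 3n\<close>, 8 the source address \<open>i * n + j\<close>, and 9 is the target
  address.
\<close>

definition write_A :: "'a com" where
  "write_A =
     Seq (IAdd 9 5 0) (Seq (IAdd 9 9 6) (Seq (RCopy (3, 9) (0, 8))
    (Seq (IAdd 9 3 7) (Seq (IAdd 9 9 4) (RCopy (3, 9) (0, 8))))))"

text \<open>The addresses are \<open>(n + i) * 3n + (2n + j)\<close> and its mirror
  \<open>(2n + j) * 3n + (n + i)\<close>, assembled by additions only.\<close>

definition write_B :: "'a com" where
  "write_B =
     Seq (IAdd 9 3 5) (Seq (IAdd 9 9 0) (Seq (IAdd 9 9 0) (Seq (IAdd 9 9 6)
    (Seq (RCopy (4, 9) (1, 8))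
    (Seq (IAdd 9 3 3) (Seq (IAdd 9 9 7) (Seq (IAdd 9 9 0) (Seq (IAdd 9 9 4)
    (RCopy (4, 9) (1, 8))))))))))"

definition write_C :: "'a com" where
  "write_C = Seq (IAdd 9 5 0) (Seq (IAdd 9 9 0) (Seq (IAdd 9 9 6) (RCopy (5, 9) (2, 8))))"

definition next_column :: "'a com" where
  "next_column = Seq (IAdd 6 6 1) (Seq (IAdd 7 7 2) (IAdd 8 8 1))"

definition entry_prog :: "'a com" where
  "entry_prog = Seq write_A (Seq write_B (Seq write_C next_column))"

text \<open>Register 8 is not reset: after \<open>n\<close> columns it holds
  \<open>i * n + n\<close>, the start of the next row.\<close>

definition row_prog :: "'a com" where
  "row_prog = Seq (Seq (IConst 6 0) (IConst 7 0)) (Seq (WhileLess 6 0 entry_prog)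
     (Seq (IAdd 4 4 1) (IAdd 5 5 2)))"

text \<open>Index registers cannot multiply, so \<open>n * 3n\<close> comes from \<open>n\<close>
  additions of \<open>3n\<close>; register 4 counts them and is then cleared for the row
  loop.\<close>

definition setup_prog :: "'a com" where
  "setup_prog = Seq (Seq (IConst 1 1) (Seq (IAdd 2 0 0) (IAdd 2 2 0)))
     (Seq (WhileLess 4 0 (Seq (IAdd 3 3 2) (IAdd 4 4 1))) (IConst 4 0))"

text \<open>Register 0 serves as loop bound and offset until the end, and only then takes the output
  dimension \<open>3n\<close>.\<close>

definition reduction_prog :: "'a com" where
  "reduction_prog = Seq setup_prog (Seq (WhileLess 4 0 row_prog) (ICopy 0 2))"

section \<open>Loop invariants and time bounds of the loops\<close>

definition constants_ok :: "nat \<Rightarrow> ('a::ring) mat_triple \<Rightarrow> 'a state \<Rightarrow> bool" where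
  "constants_ok n = (\<lambda>(A, B, C) s. reg s 0 = n \<and> reg s 1 = 1 \<and> reg s 2 = 3 * n \<and>
     arr s 0 = row_major n A \<and> arr s 1 = row_major n B \<and> arr s 2 = row_major n C)"

definition output_ok :: "nat \<Rightarrow> ('a::ring) mat_triple \<Rightarrow> nat \<Rightarrow> 'a state \<Rightarrow> bool" where
  "output_ok n = (\<lambda>(A, B, C) k s.
     mat_of_array (3 * n) (arr s 3) = sym_block n 0 1 (prefix_mat n k A) \<and>
     mat_of_array (3 * n) (arr s 4) = sym_block n 1 2 (prefix_mat n k B) \<and>
     mat_of_array (3 * n) (arr s 5) = block n 0 2 (prefix_mat n k C))"

definition row_inv :: "nat \<Rightarrow> ('a::ring) mat_triple \<Rightarrow> nat \<Rightarrow> 'a state \<Rightarrow> bool" where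
  "row_inv n I i s \<longleftrightarrow> constants_ok n I s \<and> output_ok n I (i * n) s \<and>
     reg s 3 = n * (3 * n) \<and> reg s 4 = i \<and> reg s 5 = i * (3 * n) \<and> reg s 8 = i * n"

definition entry_inv :: "nat \<Rightarrow> ('a::ring) mat_triple \<Rightarrow> nat \<Rightarrow> nat \<Rightarrow> 'a state \<Rightarrow> bool" where
  "entry_inv n I i j s \<longleftrightarrow> constants_ok n I s \<and> output_ok n I (i * n + j) s \<and>
     reg s 3 = n * (3 * n) \<and> reg s 4 = i \<and> reg s 5 = i * (3 * n) \<and>
     reg s 6 = j \<and> reg s 7 = j * (3 * n) \<and> reg s 8 = i * n + j"

lemma row_major_index:
  assumes "i < n" "j < n"
  shows "row_major n A (i * n + j) = A $$ (i, j)"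
  using assms by (simp add: row_major_def row_major_index_less)

lemmas state_simps = get_def put_def set_reg_def

text \<open>The program is straight-line; 23 = 6 + 10 + 4 + 3 counts the three writes and the column
  step.\<close>

lemma halts_within_entry_prog:
  fixes I :: "('a::ring) mat_triple"
  assumes "i < n" "j < n" "entry_inv n I i j s"
  shows "halts_within entry_prog s 23 (entry_inv n I i (Suc j))"
proof -
  obtain A B C where I: "I = (A, B, C)"
    by (cases I)
  let ?m = "3 * n" and ?k = "i * n + j"
  define s' where "s' = run entry_prog s"
  have inv: "reg s 0 = n" "reg s 1 = 1" "reg s 2 = ?m" "reg s 3 = n * ?m" "reg s 4 = i"
      "reg s 5 = i * ?m" "reg s 6 = j" "reg s 7 = j * ?m" "reg s 8 = ?k"
      "arr s 0 = row_major n A" "arr s 1 = row_major n B" "arr s 2 = row_major n C"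
      "mat_of_array ?m (arr s 3) = sym_block n 0 1 (prefix_mat n ?k A)"
      "mat_of_array ?m (arr s 4) = sym_block n 1 2 (prefix_mat n ?k B)"
      "mat_of_array ?m (arr s 5) = block n 0 2 (prefix_mat n ?k C)"
    using assms(3) by (simp_all add: entry_inv_def constants_ok_def output_ok_def I)
  note prog_defs = entry_prog_def write_A_def write_B_def write_C_def next_column_def
  note addr = row_major_index[OF assms(1,2), unfolded add.commute[of "i * n"]]
  have regs: "reg s' 0 = n" "reg s' 1 = 1" "reg s' 2 = ?m" "reg s' 3 = n * ?m" "reg s' 4 = i"
      "reg s' 5 = i * ?m" "reg s' 6 = Suc j" "reg s' 7 = Suc j * ?m" "reg s' 8 = Suc ?k"
    and inputs: "arr s' 0 = arr s 0" "arr s' 1 = arr s 1" "arr s' 2 = arr s 2"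
    by (simp_all add: s'_def prog_defs state_simps inv del: One_nat_def)
  \<comment> \<open>Block offsets such as \<open>0 * n\<close> and \<open>1 * n\<close> stay
    explicit so that \<open>mat_of_array_upd\<close> and \<open>sym_block_upd_mat\<close> match
    literally.\<close>
  have 3: "arr s' 3 = (arr s 3)
      ((0 * n + i) * ?m + (1 * n + j) := A $$ (i, j), (1 * n + j) * ?m + (0 * n + i) := A $$ (i, j))"
    by (simp add: s'_def prog_defs state_simps inv addr algebra_simps del: One_nat_def)
  have 4: "arr s' 4 = (arr s 4)
      ((1 * n + i) * ?m + (2 * n + j) := B $$ (i, j), (2 * n + j) * ?m + (1 * n + i) := B $$ (i, j))"
    by (simp add: s'_def prog_defs state_simps inv addr algebra_simps del: One_nat_def)
  have 5: "arr s' 5 = (arr s 5)((0 * n + i) * ?m + (2 * n + j) := C $$ (i, j))"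
    by (simp add: s'_def prog_defs state_simps inv addr algebra_simps del: One_nat_def)
  have less: "0 * n + i < ?m" "1 * n + i < ?m" "1 * n + j < ?m" "2 * n + j < ?m"
    using assms by auto
  have "mat_of_array ?m (arr s' 3) = sym_block n 0 1 (prefix_mat n (Suc ?k) A)"
    unfolding 3 mat_of_array_upd[OF less(1)] mat_of_array_upd[OF less(3)] inv
      prefix_mat_Suc[OF assms(2)]
    by (rule sym_block_upd_mat[symmetric]) (use assms in auto)
  moreover have "mat_of_array ?m (arr s' 4) = sym_block n 1 2 (prefix_mat n (Suc ?k) B)"
    unfolding 4 mat_of_array_upd[OF less(2)] mat_of_array_upd[OF less(4)] inv
      prefix_mat_Suc[OF assms(2)]
    by (rule sym_block_upd_mat[symmetric]) (use assms in auto)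
  moreover have "mat_of_array ?m (arr s' 5) = block n 0 2 (prefix_mat n (Suc ?k) C)"
    unfolding 5 mat_of_array_upd[OF less(4)] inv prefix_mat_Suc[OF assms(2)]
    by (rule block_upd_mat[symmetric]) (use assms in auto)
  ultimately have "entry_inv n I i (Suc j) s'"
    by (simp add: entry_inv_def constants_ok_def output_ok_def I regs inputs inv del: One_nat_def)
  moreover have "straight (entry_prog :: 'a com)" "steps (entry_prog :: 'a com) \<le> 23"
    by (simp_all add: prog_defs)
  ultimately show ?thesis
    unfolding s'_def by (intro halts_within_straight)
qed

text \<open>The bound stays an unevaluated sum so that it unifies with the sequence and loop
  rules.\<close>

lemma halts_within_row_prog:
  assumes "i < n" "row_inv n I i s"
  shows "halts_within row_prog s (2 + ((n * (23 + 1) + 1) + 2)) (row_inv n I (Suc i))"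
  unfolding row_prog_def
proof (intro halts_within_Seq)
  show "halts_within (Seq (IConst 6 0) (IConst 7 0)) s 2 (entry_inv n I i 0)"
    using assms
    by (cases I, intro halts_within_straight)
      (simp_all add: row_inv_def entry_inv_def constants_ok_def output_ok_def state_simps)
next
  fix s' assume "entry_inv n I i 0 s'"
  then show "halts_within (WhileLess 6 0 entry_prog) s' (n * (23 + 1) + 1) (entry_inv n I i n)"
    using assms(1)
    by (intro halts_within_WhileLess[where J = "entry_inv n I i"] halts_within_entry_prog)
      (auto simp: entry_inv_def constants_ok_def)
next
  fix s' assume "entry_inv n I i n s'"
  then show "halts_within (Seq (IAdd 4 4 1) (IAdd 5 5 2)) s' 2 (row_inv n I (Suc i))"
    by (cases I, intro halts_within_straight)
      (simp_all add: row_inv_def entry_inv_def constants_ok_def output_ok_def state_simps add.commute)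
qed

lemma mat_of_array_0: "mat_of_array m (\<lambda>_. 0) = 0\<^sub>m m m"
  by (intro eq_matI) (auto simp: mat_of_array_def)

lemma halts_within_setup_prog:
  fixes I :: "('a::ring) mat_triple"
  shows "halts_within setup_prog (init_state n I) (3 + ((n * (2 + 1) + 1) + 1)) (row_inv n I 0)"
  unfolding setup_prog_def
proof (intro halts_within_Seq)
  \<comment> \<open>Nothing has been copied yet, hence prefix length 0; the loop changes only
    registers 3 and 4.\<close>
  define K :: "nat \<Rightarrow> 'a state \<Rightarrow> bool" where
    "K k s \<longleftrightarrow> constants_ok n I s \<and> output_ok n I 0 s \<and>
      reg s 3 = k * (3 * n) \<and> reg s 4 = k \<and> reg s 5 = 0 \<and> reg s 8 = 0" for k s
  show "halts_within (Seq (IConst 1 1) (Seq (IAdd 2 0 0) (IAdd 2 2 0))) (init_state n I) 3 (K 0)"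
    by (cases I, intro halts_within_straight)
      (simp_all add: K_def constants_ok_def output_ok_def init_state_def state_simps prefix_mat_0
        sym_block_0 block_0 mat_of_array_0)
  show "halts_within (WhileLess 4 0 (Seq (IAdd 3 3 2) (IAdd 4 4 1))) s (n * (2 + 1) + 1) (K n)"
    if "K 0 s" for s
    using that
    by (cases I, intro halts_within_WhileLess[where J = K] halts_within_straight)
      (simp_all add: K_def constants_ok_def output_ok_def state_simps)
  show "halts_within (IConst 4 0) s 1 (row_inv n I 0)" if "K n s" for s
    using that
    by (cases I, intro halts_within_straight)
      (simp_all add: K_def row_inv_def constants_ok_def output_ok_def state_simps)
qed

section \<open>Total running time and correctness\<close>

definition reduction_time :: "nat \<Rightarrow> nat" where
  "reduction_time n = 24 * n ^ 2 + 9 * n + 7"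

lemma halts_within_reduction_prog:
  assumes "A \<in> carrier_mat n n" "B \<in> carrier_mat n n" "C \<in> carrier_mat n n"
  shows "halts_within reduction_prog (init_state n (A, B, C)) (reduction_time n)
    (\<lambda>s. out_dim s = 3 * n \<and> out_triple s = (sym_block n 0 1 A, sym_block n 1 2 B, block n 0 2 C))"
    (is "halts_within _ _ _ ?Q")
proof -
  let ?I = "(A, B, C)"
  let ?b = "2 + ((n * (23 + 1) + 1) + 2)"
  have "halts_within reduction_prog (init_state n ?I)
      ((3 + ((n * (2 + 1) + 1) + 1)) + ((n * (?b + 1) + 1) + 1)) ?Q"
    unfolding reduction_prog_def
  proof (intro halts_within_Seq)
    show "halts_within setup_prog (init_state n ?I) (3 + ((n * (2 + 1) + 1) + 1)) (row_inv n ?I 0)"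
      by (rule halts_within_setup_prog)
    show "halts_within (WhileLess 4 0 row_prog) s (n * (?b + 1) + 1) (row_inv n ?I n)"
      if "row_inv n ?I 0 s" for s
      using that
      by (intro halts_within_WhileLess[where J = "row_inv n ?I"] halts_within_row_prog)
        (auto simp: row_inv_def constants_ok_def)
    \<comment> \<open>\<open>n\<close> finished rows mean prefix length \<open>n * n\<close>, the
      whole of each matrix.\<close>
    show "halts_within (ICopy 0 2) s 1 ?Q" if "row_inv n ?I n s" for s
      using that assms
      by (intro halts_within_straight)
        (simp_all add: row_inv_def constants_ok_def output_ok_def state_simps out_dim_def
          out_triple_def prefix_mat_full)
  qed
  \<comment> \<open>The budgets are \<open>3n + 5\<close> for setup, \<open>24n^2 + 6n + 1\<close>
    for the row loop and 1 for the last copy.\<close>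
  then show ?thesis
    by (rule halts_within_mono) (auto simp: reduction_time_def power2_eq_square algebra_simps)
qed

theorem theorem5p4:
  shows "\<exists>(c :: ('a::ring) com) (T :: nat \<Rightarrow> nat).
    (\<lambda>n. real (T n)) \<in> O(\<lambda>n. real n ^ 2) \<and>
    reduction_in_time c T MMV SymMMV (\<lambda>n. 3 * n)"
proof (intro exI conjI)
  \<comment> \<open>40 = 24 + 9 + 7, as both \<open>n\<close> and 1 are at most \<open>n ^ 2\<close>
    here.\<close>
  have "real (reduction_time n) \<le> 40 * real n ^ 2" if "n \<ge> 1" for n
  proof -
    have "n \<le> n ^ 2" "1 \<le> n ^ 2"
      using that by (auto simp: power2_eq_square)
    then have "reduction_time n \<le> 40 * n ^ 2"
      unfolding reduction_time_def by linarith
    then have "real (reduction_time n) \<le> real (40 * n ^ 2)"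
      by (rule of_nat_mono)
    then show ?thesis
      by simp
  qed
  then show "(\<lambda>n. real (reduction_time n)) \<in> O(\<lambda>n. real n ^ 2)"
    by (intro bigoI[where c = 40] eventually_sequentiallyI[where c = 1]) simp
next
  show "reduction_in_time (reduction_prog :: 'a com) reduction_time MMV SymMMV (\<lambda>n. 3 * n)"
    unfolding reduction_in_time_def
  proof (intro allI ballI)
    fix n and I :: "'a mat_triple"
    assume "I \<in> instances MMV n"
    then obtain A B C where I: "I = (A, B, C)" and
      ABC: "A \<in> carrier_mat n n" "B \<in> carrier_mat n n" "C \<in> carrier_mat n n"
      by (auto simp: MMV_def)
    let ?O = "(sym_block n 0 1 A, sym_block n 1 2 B, block n 0 2 C)"
    obtain t s where "exec reduction_prog (init_state n I) t s" "t \<le> reduction_time n"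
      "out_dim s = 3 * n" "out_triple s = ?O"
      using halts_within_reduction_prog[OF ABC] unfolding halts_within_def I by blast
    moreover have "?O \<in> instances SymMMV (3 * n)"
      using ABC by (simp add: SymMMV_def symmetric_sym_block)
    \<comment> \<open>The product of the factors is \<open>block n 0 2 (A * B)\<close>, and by
      injectivity it equals \<open>block n 0 2 C\<close> exactly when
      \<open>A * B = C\<close>.\<close>
    moreover have "yes MMV I \<longleftrightarrow> yes SymMMV ?O"
      using ABC sym_block_mult_sym_block[OF ABC(1,2)] block_inject[of "A * B" n C 0 2]
      by (simp add: MMV_def SymMMV_def I)
    ultimately show "\<exists>t s. exec reduction_prog (init_state n I) t s \<and> t \<le> reduction_time n \<and>
        out_dim s = 3 * n \<and> out_triple s \<in> instances SymMMV (3 * n) \<and>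
        (yes MMV I \<longleftrightarrow> yes SymMMV (out_triple s))"
      by metis
  qed
qed

end
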